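(* For each integer $k\geq 0$, let $N_k=3\cdot 4^k$. Then there exists a set $C_k\subseteq \mathbb{N}$ such that $R_2(C_k,n)=R_2(\mathbb{N}\setminus C_k,n)$ for all integers $n\geq 2N_k-1$, $|C_k\cap A_0|=+\infty$, $|C_k\cap B_0|=+\infty$, and $$R_2\left(C_k,\tfrac{14}{3}N_k-1\right)=0.$$
   Context: $\mathbb{N}$ denotes the set of nonnegative integers (including $0$). For $A\subseteq\mathbb{N}$ and an integer $n$, $R_2(A,n)$ denotes the number of solutions of $n=a+a'$ with $a,a'\in A$ and $a<a'$. For $a\in\mathbb{N}$, $D(a)$ is the number of ones in the binary representation of $a$ (with $D(0)=0$). $A_0$ is the set of all $a\in\mathbb{N}$ with $D(a)$ even (the Thue–Morse set), and $B_0=\mathbb{N}\setminus A_0$. *)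

theory Defs
  imports Complex_Main
begin

text \<open>The representation function takes an integer argument, so that no expression such as
  \<open>2 * N k - 1\<close> involves truncated subtraction.\<close>

definition R2 :: "nat set \<Rightarrow> int \<Rightarrow> nat" where
  "R2 A n = card {(a, a'). a \<in> A \<and> a' \<in> A \<and> a < a' \<and> n = int a + int a'}"

lemma finite_R2_set:
  "finite {(a, a'). a \<in> A \<and> a' \<in> A \<and> a < a' \<and> n = int a + int a'}"
  by (rule finite_subset[of _ "{..nat n} \<times> {..nat n}"]) auto

definition D :: "nat \<Rightarrow> nat" where
  "D a = card {i. bit a i}"

lemma finite_bits: "finite {i. bit (a :: nat) i}"
proof (rule finite_subset)
  show "{i. bit a i} \<subseteq> {..a}"
  proof
    fix i assume "i \<in> {i. bit a i}"
    then have "a div 2 ^ i > 0"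
      by (auto simp: bit_iff_odd intro: odd_pos)
    then have "2 ^ i \<le> a"
      by (simp add: div_greater_zero_iff)
    then show "i \<in> {..a}"
      using less_exp[of i] by (simp del: less_exp)
  qed
qed simp

definition A0 :: "nat set" where
  "A0 = {a. even (D a)}"

definition B0 :: "nat set" where
  "B0 = UNIV - A0"

definition N :: "nat \<Rightarrow> int" where
  "N k = 3 * 4 ^ k"

text \<open>The division by 3 is exact, so \<open>14 * N k div 3 - 1\<close> is the number
  \<open>14 / 3 * N k - 1\<close>.\<close>

lemma N_div_exact:
  "real_of_int (14 * N k div 3 - 1) = 14 / 3 * real_of_int (N k) - 1"
  by (simp add: N_def)

end

theory Submission
  imports Defs
begin

text \<open>
  Writing \<open>s a = 1\<close> for \<open>a \<in> A\<close> and \<open>s a = -1\<close> otherwise, a pair \<open>a < a'\<close> contributes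
  \<open>(s a + s a') / 2\<close> to \<open>R\<^sub>2(A, n) - R\<^sub>2(\<nat> \<setminus> A, n)\<close>, so twice this difference is the sum of
  all \<open>s a\<close> with \<open>a \<le> n\<close> and \<open>2 a \<noteq> n\<close>. If \<open>A\<close> contains exactly one of \<open>2 m\<close> and \<open>2 m + 1\<close>
  for every \<open>m\<close>, the sum of \<open>s\<close> over an initial segment of even length vanishes; what remains for
  even \<open>n = 2 m\<close> is \<open>s (2 m) - s m\<close>, which is \<open>0\<close> as soon as \<open>2 m \<in> A \<longleftrightarrow> m \<in> A\<close>.

  The set \<open>C\<^sub>k\<close> is the complement of the Thue--Morse set, with membership switched on the
  intervals \<open>[4 \<sqdot> 2\<^sup>j \<sqdot> 4\<^sup>k, 6 \<sqdot> 2\<^sup>j \<sqdot> 4\<^sup>k)\<close>. It contains exactly one of any two numbers with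
  sum \<open>14 \<sqdot> 4\<^sup>k - 1\<close>: for \<open>k = 0\<close> this is a finite check, and appending two binary digits
  \<open>i\<close> to the one and the digits of \<open>3 - i\<close> to the other passes from \<open>k\<close> to \<open>k + 1\<close>.
\<close>

section \<open>Binary digit sums\<close>

lemma D_0 [simp]: "D 0 = 0"
  by (simp add: D_def)

lemma D_double [simp]: "D (2 * m) = D m"
proof -
  have "{i. bit (2 * m) i} = Suc ` {i. bit m i}"
  proof (intro set_eqI)
    fix i show "i \<in> {i. bit (2 * m) i} \<longleftrightarrow> i \<in> Suc ` {i. bit m i}"
      by (cases i) (auto simp: bit_0 bit_Suc)
  qed
  then show ?thesis
    by (simp add: D_def card_image)
qed

lemma D_double_Suc [simp]: "D (Suc (2 * m)) = Suc (D m)"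
proof -
  have "{i. bit (Suc (2 * m)) i} = insert 0 (Suc ` {i. bit m i})"
  proof (intro set_eqI)
    fix i show "i \<in> {i. bit (Suc (2 * m)) i} \<longleftrightarrow> i \<in> insert 0 (Suc ` {i. bit m i})"
      by (cases i) (auto simp: bit_0 bit_Suc)
  qed
  then show ?thesis
    by (simp add: D_def card_image finite_bits)
qed

lemma D_rec: "D n = D (n div 2) + n mod 2"
proof (cases "even n")
  case True
  then show ?thesis by (metis D_double add_0_right dvd_mult_div_cancel even_iff_mod_2_eq_zero)
next
  case False
  then show ?thesis
    by (metis D_double_Suc Suc_eq_plus1 odd_iff_mod_2_eq_one odd_two_times_div_two_succ)
qed

text \<open>As simp rules these evaluate \<open>D\<close> on numerals in the finite checks
  below.\<close>

lemma D_numeral [simp]: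
  "D 1 = 1"
  "D (Suc 0) = 1"
  "D (numeral (num.Bit0 m)) = D (numeral m)"
  "D (numeral (num.Bit1 m)) = Suc (D (numeral m))"
  using D_double_Suc[of 0] D_double[of "numeral m"] D_double_Suc[of "numeral m"]
  by (simp_all del: D_double D_double_Suc add: numeral_Bit0 numeral_Bit1 mult_2)

lemma D_mult_power4: "D (q * 4 ^ k) = D q"
proof (induction k)
  case (Suc k)
  have "q * 4 ^ Suc k = 2 * (2 * (q * 4 ^ k))" by simp
  then show ?case using Suc by (simp only: D_double)
qed simp

section \<open>Representation counts as signed sums\<close>

lemma R2_eq_card:
  "R2 A (int n) = card {a. 2 * a < n \<and> a \<in> A \<and> n - a \<in> A}"
proof -
  have "{(a, a'). a \<in> A \<and> a' \<in> A \<and> a < a' \<and> int n = int a + int a'}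
      = (\<lambda>a. (a, n - a)) ` {a. 2 * a < n \<and> a \<in> A \<and> n - a \<in> A}"
    (is "?P = ?Q")
  proof (intro set_eqI iffI)
    fix p assume "p \<in> ?P"
    then obtain a a' where "p = (a, a')" "a \<in> A" "a' \<in> A" "a < a'" "n = a + a'"
      by auto
    then show "p \<in> ?Q"
      by (intro image_eqI[of _ _ a]) auto
  qed auto
  then show ?thesis
    by (simp add: R2_def card_image inj_on_def)
qed

lemma R2_diff_eq_sum:
  fixes A :: "nat set" and n :: nat
  defines "s \<equiv> \<lambda>a. if a \<in> A then 1 else - 1 :: int"
  shows "2 * (int (R2 A (int n)) - int (R2 (UNIV - A) (int n)))
       = (\<Sum>a \<in> {a. a \<le> n \<and> 2 * a \<noteq> n}. s a)"
proof -
  let ?L = "{a. 2 * a < n}"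
  have fin: "finite ?L"
    by (rule finite_subset[of _ "{..n}"]) auto
  have card: "int (R2 X (int n)) = (\<Sum>a \<in> ?L. if a \<in> X \<and> n - a \<in> X then 1 else 0)" for X
    using fin by (simp add: R2_eq_card sum.If_cases Int_def)
  have "2 * (int (R2 A (int n)) - int (R2 (UNIV - A) (int n))) = (\<Sum>a \<in> ?L. s a + s (n - a))"
    unfolding card sum_subtractf[symmetric] sum_distrib_left
    by (rule sum.cong) (auto simp: s_def)
  also have "\<dots> = sum s ?L + sum s ((\<lambda>a. n - a) ` ?L)"
    by (subst sum.reindex) (auto simp: inj_on_def sum.distrib)
  also have "\<dots> = sum s (?L \<union> (\<lambda>a. n - a) ` ?L)"
    using fin by (subst sum.union_disjoint) auto
  also have "?L \<union> (\<lambda>a. n - a) ` ?L = {a. a \<le> n \<and> 2 * a \<noteq> n}"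
  proof (intro set_eqI iffI)
    fix a assume a: "a \<in> {a. a \<le> n \<and> 2 * a \<noteq> n}"
    then have "a = n - (n - a)" "2 * a < n \<or> 2 * (n - a) < n" by auto
    then show "a \<in> ?L \<union> (\<lambda>a. n - a) ` ?L" by blast
  qed auto
  finally show ?thesis .
qed

lemma R2_eq_R2_compl:
  fixes A :: "nat set" and N n :: nat
  assumes alt: "\<And>m. Suc (2 * m) \<in> A \<longleftrightarrow> 2 * m \<notin> A"
    and double: "\<And>m. m \<ge> N \<Longrightarrow> 2 * m \<in> A \<longleftrightarrow> m \<in> A"
    and n: "n + 1 \<ge> 2 * N"
  shows "R2 A (int n) = R2 (UNIV - A) (int n)"
proof -
  define s where "s = (\<lambda>a. if a \<in> A then 1 else - 1 :: int)"
  have zero: "sum s {..<2 * m} = 0" for m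
    by (induction m) (use alt in \<open>auto simp: s_def\<close>)
  have "sum s {a. a \<le> n \<and> 2 * a \<noteq> n} = 0"
  proof (cases "even n")
    case True
    then obtain m where m: "n = 2 * m" by blast
    have "{a. a \<le> n \<and> 2 * a \<noteq> n} = {..<Suc (2 * m)} - {m}"
      using m by auto
    then have "sum s {a. a \<le> n \<and> 2 * a \<noteq> n} = s (2 * m) - s m"
      using zero[of m] by (simp add: sum_diff1)
    \<comment> \<open>By parity \<open>2 * m + 1 \<ge> 2 * N\<close> already forces
      \<open>m \<ge> N\<close>; hence \<open>n = 2 * N - 1\<close> is an admissible start.\<close>
    also have "\<dots> = 0"
      using double[of m] m n by (simp add: s_def)
    finally show ?thesis .
  next
    case False
    then obtain m where m: "n = Suc (2 * m)" by (metis oddE Suc_eq_plus1)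
    have "{a. a \<le> n \<and> 2 * a \<noteq> n} = {..<2 * Suc m}"
      using m by (auto, presburger)
    then show ?thesis
      using zero[of "Suc m"] by (simp only:)
  qed
  then show ?thesis
    using R2_diff_eq_sum[of A n] by (simp add: s_def)
qed

section \<open>The switched set and doubling\<close>

definition switched :: "nat \<Rightarrow> nat \<Rightarrow> bool" where
  "switched k x \<longleftrightarrow> (\<exists>j. 4 * 2 ^ j * 4 ^ k \<le> x \<and> x < 6 * 2 ^ j * 4 ^ k)"

definition C :: "nat \<Rightarrow> nat set" where
  "C k = {x. odd (D x) \<noteq> switched k x}"

text \<open>All interval endpoints are even, so none separates \<open>2 * m\<close> from its
  successor.\<close>

lemma switched_double_Suc: "switched k (Suc (2 * m)) \<longleftrightarrow> switched k (2 * m)"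
proof -
  have "4 * c \<le> Suc (2 * m) \<and> Suc (2 * m) < 6 * c \<longleftrightarrow> 4 * c \<le> 2 * m \<and> 2 * m < 6 * c" for c
    by auto
  then show ?thesis
    by (simp only: switched_def mult.assoc)
qed

text \<open>Doubling carries interval \<open>j\<close> to interval \<open>j + 1\<close>. Only
  interval 0 has no predecessor, and it ends at \<open>6 * 4 ^ k \<le> 2 * m\<close>.\<close>

lemma switched_double:
  assumes "m \<ge> 3 * 4 ^ k"
  shows "switched k (2 * m) \<longleftrightarrow> switched k m"
proof
  assume "switched k (2 * m)"
  then obtain j where j: "4 * 2 ^ j * 4 ^ k \<le> 2 * m" "2 * m < 6 * 2 ^ j * 4 ^ k"
    by (auto simp: switched_def)
  then obtain i where "j = Suc i"
    using assms by (cases j) auto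
  then show "switched k m"
    using j unfolding switched_def by (intro exI[of _ i]) simp
next
  assume "switched k m"
  then obtain j where "4 * 2 ^ j * 4 ^ k \<le> m" "m < 6 * 2 ^ j * 4 ^ k"
    by (auto simp: switched_def)
  then show "switched k (2 * m)"
    unfolding switched_def by (intro exI[of _ "Suc j"]) simp
qed

lemma C_double_Suc: "Suc (2 * m) \<in> C k \<longleftrightarrow> 2 * m \<notin> C k"
  by (auto simp: C_def switched_double_Suc)

lemma C_double: "m \<ge> 3 * 4 ^ k \<Longrightarrow> 2 * m \<in> C k \<longleftrightarrow> m \<in> C k"
  by (simp add: C_def switched_double)

section \<open>Base-4 recursion and reflection\<close>

text \<open>The endpoints for \<open>Suc k\<close> are 4 times those for \<open>k\<close>, so the
  last two binary digits do not matter.\<close>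

lemma switched_Suc: "switched (Suc k) x \<longleftrightarrow> switched k (x div 4)"
proof -
  have "4 * (4 * c) \<le> x \<and> x < 6 * (4 * c) \<longleftrightarrow> 4 * c \<le> x div 4 \<and> x div 4 < 6 * c" for c
    by (simp add: less_eq_div_iff_mult_less_eq div_less_iff_less_mult mult.commute)
  moreover have "2 ^ j * 4 ^ Suc k = 4 * (2 ^ j * 4 ^ k :: nat)" for j
    by simp
  ultimately show ?thesis
    by (simp only: switched_def mult.assoc)
qed

lemma odd_D_div4: "odd (D x) \<longleftrightarrow> odd (D (x div 4)) \<noteq> (x mod 4 \<in> {1, 2})"
proof -
  have "D x = D (x div 2 div 2) + x div 2 mod 2 + x mod 2"
    by (metis D_rec)
  moreover have "x div 2 div 2 = x div 4" "x mod 4 = 2 * (x div 2 mod 2) + x mod 2"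
    using mod_mult2_eq[of x 2 2] by (simp_all add: div_mult2_eq[symmetric])
  moreover have "x mod 2 = 0 \<or> x mod 2 = 1" "x div 2 mod 2 = 0 \<or> x div 2 mod 2 = 1"
    by linarith+
  ultimately show ?thesis
    by (elim disjE) (simp_all only:, simp_all)
qed

lemma C_Suc: "x \<in> C (Suc k) \<longleftrightarrow> (x div 4 \<in> C k) \<noteq> (x mod 4 \<in> {1, 2})"
  unfolding C_def mem_Collect_eq switched_Suc by (subst odd_D_div4) blast

lemma switched_0:
  assumes "x < 14"
  shows "switched 0 x \<longleftrightarrow> x \<in> {4, 5, 8, 9, 10, 11}"
proof
  assume "switched 0 x"
  then obtain j where j: "4 * 2 ^ j \<le> x" "x < 6 * 2 ^ j"
    by (auto simp: switched_def)
  \<comment> \<open>Interval 2 starts at 16, beyond the range \<open>x < 14\<close>.\<close>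
  have "j < 2"
  proof (rule ccontr)
    assume "\<not> j < 2"
    then have "(2::nat) ^ 2 \<le> 2 ^ j"
      by (intro power_increasing) auto
    then show False using j assms by simp
  qed
  then have "j = 0 \<or> j = 1" by auto
  then show "x \<in> {4, 5, 8, 9, 10, 11}"
    using j by auto
next
  assume "x \<in> {4, 5, 8, 9, 10, 11}"
  then show "switched 0 x"
    unfolding switched_def
    by (cases "x < 6") (auto intro: exI[of _ "0 :: nat"] exI[of _ "1 :: nat"])
qed

lemma less_14_cases:
  fixes x :: nat
  assumes "x < 14"
  shows "x \<in> {0, 1, 2, 3, 4, 5, 6, 7, 8, 9, 10, 11, 12, 13}"
proof -
  have "x \<in> {..<14}" using assms by simp
  then show ?thesis
    by (simp add: lessThan_nat_numeral) blast
qed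

lemma C_0:
  assumes "x < 14"
  shows "x \<in> C 0 \<longleftrightarrow> x \<in> {1, 2, 5, 7, 9, 10, 13}"
  using less_14_cases[OF assms] by (elim insertE) (simp_all add: C_def switched_0)

lemma C_reflect:
  assumes "Suc (x + y) = 14 * 4 ^ k"
  shows "y \<in> C k \<longleftrightarrow> x \<notin> C k"
  using assms
proof (induction k arbitrary: x y)
  case 0
  then have y: "y = 13 - x" and "x < 14" by auto
  from less_14_cases[OF \<open>x < 14\<close>] show ?case
    unfolding y by (elim insertE) (simp_all add: C_0)
next
  case (Suc k)
  define M :: nat where "M = 4 ^ k"
  have "Suc (x + y) = 4 * (14 * M)"
    using Suc.prems by (simp add: M_def)
  then have sum: "Suc (4 * (x div 4) + x mod 4 + (4 * (y div 4) + y mod 4)) = 4 * (14 * M)"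
    by simp
  moreover have "x mod 4 < 4" "y mod 4 < 4"
    by simp_all
  \<comment> \<open>\<open>Suc (x mod 4 + y mod 4)\<close> is a multiple of 4 between 1 and 7, hence
    4.\<close>
  ultimately have div: "Suc (x div 4 + y div 4) = 14 * M"
    by linarith
  with sum have mod: "x mod 4 + y mod 4 = 3"
    by linarith
  have "y div 4 \<in> C k \<longleftrightarrow> x div 4 \<notin> C k"
    using Suc.IH div by (simp add: M_def)
  \<comment> \<open>The reflection \<open>i \<mapsto> 3 - i\<close> preserves \<open>{1, 2}\<close>,
    so \<open>C_Suc\<close> flips both memberships or neither.\<close>
  moreover have "y mod 4 \<in> {1, 2} \<longleftrightarrow> x mod 4 \<in> {1, 2}"
    using mod by (simp only: insert_iff empty_iff) linarith
  ultimately show ?case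
    by (simp only: C_Suc) blast
qed

section \<open>Infinite intersections and conclusion\<close>

text \<open>Doubling a maximum would exceed it. Closure is asked only from \<open>x\<close> on
  because \<open>C_double\<close> has a threshold.\<close>

lemma infinite_if_double_closed:
  fixes S :: "nat set"
  assumes "x \<in> S" "x > 0" "\<And>y. y \<in> S \<Longrightarrow> y \<ge> x \<Longrightarrow> 2 * y \<in> S"
  shows "infinite S"
proof
  assume "finite S"
  then have "Max S \<in> S" "x \<le> Max S"
    using assms(1) by (auto intro: Max_in)
  then have "2 * Max S \<le> Max S"
    using assms(3) \<open>finite S\<close> by simp
  then show False
    using \<open>x \<le> Max S\<close> assms(2) by simp
qed

lemma infinite_C_Int_A0: "infinite (C k \<inter> A0)"
proof (rule infinite_if_double_closed)
  \<comment> \<open>5 is 101 in binary, with even digit sum, and lies in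
    \<open>[4, 6)\<close>.\<close>
  have "switched k (5 * 4 ^ k)"
    unfolding switched_def by (intro exI[of _ 0]) simp
  then show "5 * 4 ^ k \<in> C k \<inter> A0"
    by (simp add: C_def A0_def D_mult_power4)
qed (auto simp: C_double A0_def)

lemma infinite_C_Int_B0: "infinite (C k \<inter> B0)"
proof (rule infinite_if_double_closed)
  \<comment> \<open>7 is 111 in binary, with odd digit sum, and lies in the gap between
    \<open>[4, 6)\<close> and \<open>[8, 12)\<close>.\<close>
  have "\<not> switched k (7 * 4 ^ k)"
  proof
    assume "switched k (7 * 4 ^ k)"
    then obtain j where j: "4 * 2 ^ j \<le> (7 :: nat)" "7 < 6 * (2 :: nat) ^ j"
      by (auto simp: switched_def)
    have "(2 :: nat) ^ j = 1 \<or> (2 :: nat) ^ j \<ge> 2"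
      by (cases j) auto
    then show False
      using j by linarith
  qed
  then show "7 * 4 ^ k \<in> C k \<inter> B0"
    by (simp add: C_def A0_def B0_def D_mult_power4)
qed (auto simp: C_double A0_def B0_def)

theorem theorem2:
  fixes k :: nat
  shows "\<exists>C :: nat set.
           (\<forall>n :: int. n \<ge> 2 * N k - 1 \<longrightarrow> R2 C n = R2 (UNIV - C) n) \<and>
           infinite (C \<inter> A0) \<and>
           infinite (C \<inter> B0) \<and>
           R2 C (14 * N k div 3 - 1) = 0"
proof (intro exI[of _ "C k"] conjI allI impI)
  fix n :: int assume n: "n \<ge> 2 * N k - 1"
  have N: "N k = int (3 * 4 ^ k)"
    by (simp add: N_def)
  have pos: "(3 * 4 ^ k :: nat) > 0" by simp
  have "n \<ge> 0" "nat n + 1 \<ge> 2 * (3 * 4 ^ k)"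
    using n pos unfolding N by linarith+
  then show "R2 (C k) n = R2 (UNIV - C k) n"
    using R2_eq_R2_compl[of "C k" "3 * 4 ^ k" "nat n"] C_double_Suc C_double by simp
next
  have "14 * N k div 3 - 1 = int (14 * 4 ^ k) - 1"
    by (simp add: N_def)
  moreover have "\<not> (a \<in> C k \<and> a' \<in> C k \<and> int (14 * 4 ^ k) - 1 = int a + int a')" for a a'
    using C_reflect[of a a' k] by linarith
  ultimately have "{(a, a'). a \<in> C k \<and> a' \<in> C k \<and> a < a' \<and>
      14 * N k div 3 - 1 = int a + int a'} = {}"
    by auto
  then show "R2 (C k) (14 * N k div 3 - 1) = 0"
    unfolding R2_def by (simp only: card.empty)
qed (rule infinite_C_Int_A0 infinite_C_Int_B0)+

end
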